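(* Let $A\in\mathbb{R}^{m\times n}$, $b\in\mathbb{R}^m$, and let $L\in\mathbb{R}^{n\times n}$ be the (given) graph Laplacian of an undirected weighted graph on $n$ vertices. Consider the Laplacian-regularized nonnegative least squares problem $$\min_{x\succeq 0}\ \tfrac12\|Ax-b\|_2^2+\tfrac12 x^\top L x .$$ Assume that the Moore--Penrose pseudoinverse $L^\dagger$ is known. Let $x^\star\in\mathbb{R}^n$ be a primal solution and $\lambda^\star\in\mathbb{R}^m$, $\mu^\star\in\mathbb{R}^n$ be dual solutions, with $y^\star=\lambda^\star$, satisfying the KKT conditions $$x^\star\succeq 0,\quad y^\star=Ax^\star-b,\quad \mu^\star\succeq 0,\quad (\mu^\star)^\top x^\star=0,\quad Lx^\star+A^\top\lambda^\star-\mu^\star=0 .$$ Then the primal solution can be written as $$x^\star=L^\dagger(\mu^\star-A^\top\lambda^\star)+c\,\mathbf{1},\qquad c\in\mathbb{R},$$ where $c$ must be determined to satisfy the KKT conditions above.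
   Context: $\succeq$ between vectors denotes the entrywise inequality; $\mathbf{1}\in\mathbb{R}^n$ is the all-ones vector. The graph has edge set $\mathcal{E}$ and edge weights $w_{ij}\ge 0$, and its Laplacian $L$ is the symmetric positive semidefinite (singular) matrix with $x^\top Lx=\sum_{(i,j)\in\mathcal{E}}w_{ij}(x_i-x_j)^2$ for all $x\in\mathbb{R}^n$; in particular $L\mathbf{1}=0$. The dual variables come from the Lagrangian of the reformulation with auxiliary variable $y=Ax-b$, namely $\mathcal{L}(x,y;\lambda,\mu)=\tfrac12\|y\|_2^2+\tfrac12x^\top Lx+\lambda^\top(Ax-b-y)-\mu^\top x$, where $\lambda$ is the multiplier of $y=Ax-b$ and $\mu\succeq 0$ that of $x\succeq 0$; minimization over $y$ gives $y^\star=\lambda^\star$, and minimization over $x$ gives the last KKT condition.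
   Formalization: The graph is additionally assumed connected through edges of positive weight; without this the claim fails, e.g. for two vertices with no edges, L = 0, A = I, b = (1,0), where x* = (1,0), λ* = 0, μ* = 0 is not a multiple of the all-ones vector. *)

theory Defs
  imports "HOL-Analysis.Analysis"
begin

text \<open>An undirected weighted graph on the vertex set \<open>UNIV :: 'n set\<close>. Each undirected edge is
  listed once, with an arbitrary orientation, so that a sum over \<open>E\<close> counts every edge once;
  \<open>w i j\<close> is the weight of the edge listed as \<open>(i, j)\<close> and is irrelevant for other pairs.\<close>

definition undirected_weighted_graph ::
    "('n::finite \<times> 'n) set \<Rightarrow> ('n \<Rightarrow> 'n \<Rightarrow> real) \<Rightarrow> bool" where
  "undirected_weighted_graph E w \<longleftrightarrow>
     (\<forall>i j. (i, j) \<in> E \<longrightarrow> (j, i) \<notin> E) \<and> (\<forall>(i, j) \<in> E. 0 \<le> w i j)"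

text \<open>Weights may vanish, and an edge of weight zero is invisible to the Laplacian, so
  connectedness refers to the edges of positive weight.\<close>

definition connected_graph :: "('n::finite \<times> 'n) set \<Rightarrow> ('n \<Rightarrow> 'n \<Rightarrow> real) \<Rightarrow> bool" where
  "connected_graph E w \<longleftrightarrow>
     (let P = {(i, j). (i, j) \<in> E \<and> 0 < w i j} in \<forall>i j. (i, j) \<in> (P \<union> P\<inverse>)\<^sup>*)"

text \<open>A symmetric matrix is determined by its quadratic form, so there is exactly one such \<open>L\<close>.\<close>

definition is_graph_laplacian ::
    "('n::finite \<times> 'n) set \<Rightarrow> ('n \<Rightarrow> 'n \<Rightarrow> real) \<Rightarrow> real^'n^'n \<Rightarrow> bool" where
  "is_graph_laplacian E w L \<longleftrightarrow>
     transpose L = L \<and>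
     (\<forall>x. 0 \<le> x \<bullet> (L *v x)) \<and>
     (\<forall>x. x \<bullet> (L *v x) = (\<Sum>(i, j)\<in>E. w i j * (x $ i - x $ j)\<^sup>2))"

text \<open>The four Penrose equations, which determine \<open>X\<close> uniquely.\<close>

definition is_moore_penrose_inverse ::
    "real^'n::finite^'m::finite \<Rightarrow> real^'m^'n \<Rightarrow> bool" where
  "is_moore_penrose_inverse M X \<longleftrightarrow>
     M ** X ** M = M \<and>
     X ** M ** X = X \<and>
     transpose (M ** X) = M ** X \<and>
     transpose (X ** M) = X ** M"

text \<open>The order on vectors is the library's componentwise order.\<close>

definition nnls_objective ::
    "real^'n::finite^'m::finite \<Rightarrow> real^'m \<Rightarrow> real^'n^'n \<Rightarrow> real^'n \<Rightarrow> real" where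
  "nnls_objective A b L x = 1/2 * (norm (A *v x - b))\<^sup>2 + 1/2 * (x \<bullet> (L *v x))"

definition primal_solution ::
    "real^'n::finite^'m::finite \<Rightarrow> real^'m \<Rightarrow> real^'n^'n \<Rightarrow> real^'n \<Rightarrow> bool" where
  "primal_solution A b L x \<longleftrightarrow>
     0 \<le> x \<and> (\<forall>z. 0 \<le> z \<longrightarrow> nnls_objective A b L x \<le> nnls_objective A b L z)"

definition lagrangian ::
    "real^'n::finite^'m::finite \<Rightarrow> real^'m \<Rightarrow> real^'n^'n \<Rightarrow>
     real^'n \<Rightarrow> real^'m \<Rightarrow> real^'m \<Rightarrow> real^'n \<Rightarrow> real" where
  "lagrangian A b L x y l \<mu> =
     1/2 * (norm y)\<^sup>2 + 1/2 * (x \<bullet> (L *v x)) + l \<bullet> (A *v x - b - y) - \<mu> \<bullet> x"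

text \<open>Extended-real valued, since the infimum can be \<open>-\<infinity>\<close>.\<close>

definition dual_function ::
    "real^'n::finite^'m::finite \<Rightarrow> real^'m \<Rightarrow> real^'n^'n \<Rightarrow> real^'m \<Rightarrow> real^'n \<Rightarrow> ereal" where
  "dual_function A b L l \<mu> = (INF (x, y). ereal (lagrangian A b L x y l \<mu>))"

definition dual_solution ::
    "real^'n::finite^'m::finite \<Rightarrow> real^'m \<Rightarrow> real^'n^'n \<Rightarrow> real^'m \<Rightarrow> real^'n \<Rightarrow> bool" where
  "dual_solution A b L l \<mu> \<longleftrightarrow>
     0 \<le> \<mu> \<and> (\<forall>l' \<mu>'. 0 \<le> \<mu>' \<longrightarrow> dual_function A b L l' \<mu>' \<le> dual_function A b L l \<mu>)"

definition KKT ::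
    "real^'n::finite^'m::finite \<Rightarrow> real^'m \<Rightarrow> real^'n^'n \<Rightarrow>
     real^'n \<Rightarrow> real^'m \<Rightarrow> real^'m \<Rightarrow> real^'n \<Rightarrow> bool" where
  "KKT A b L x y l \<mu> \<longleftrightarrow>
     0 \<le> x \<and>
     y = A *v x - b \<and>
     0 \<le> \<mu> \<and>
     \<mu> \<bullet> x = 0 \<and>
     L *v x + transpose A *v l - \<mu> = 0"

end

theory Submission
  imports Defs
begin

text \<open>Stationarity reads \<open>L x = \<mu> - A\<^sup>T l\<close>, and \<open>L L\<^sup>\<dagger> L = L\<close> puts \<open>x - L\<^sup>\<dagger> L x\<close> in the kernel
  of \<open>L\<close>. On that kernel the quadratic form vanishes, so every edge of positive weight joins vertices
  with equal values, and connectedness makes the vector constant.\<close>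

lemma laplacian_kernel_constant:
  fixes z :: "real^'n::finite"
  assumes "undirected_weighted_graph E w"
    and "connected_graph E w"
    and "is_graph_laplacian E w L"
    and "L *v z = 0"
  shows "\<exists>c. z = c *\<^sub>R (\<chi> i. 1)"
proof -
  define P where "P = {(i, j). (i, j) \<in> E \<and> 0 < w i j}"
  have nonneg: "0 \<le> w i j" if "(i, j) \<in> E" for i j
    using assms(1) that by (auto simp: undirected_weighted_graph_def)
  have "(\<Sum>(i, j)\<in>E. w i j * (z $ i - z $ j)\<^sup>2) = z \<bullet> (L *v z)"
    using assms(3) by (simp add: is_graph_laplacian_def)
  then have "(\<Sum>(i, j)\<in>E. w i j * (z $ i - z $ j)\<^sup>2) = 0"
    using assms(4) by simp
  \<comment> \<open>A vanishing finite sum of nonnegative terms has only zero terms;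
    \<open>E\<close> is finite because the vertex type is.\<close>
  then have "\<forall>(i, j)\<in>E. w i j * (z $ i - z $ j)\<^sup>2 = 0"
    by (subst (asm) sum_nonneg_eq_0_iff) (auto simp: nonneg)
  \<comment> \<open>Cancelling \<open>w i j\<close> needs a positive weight, hence \<open>P\<close>
    in place of \<open>E\<close>; reversed edges follow by symmetry of equality.\<close>
  then have edge: "z $ i = z $ j" if "(i, j) \<in> P \<union> P\<inverse>" for i j
    using that by (fastforce simp: P_def)
  have reach: "z $ i = z $ j" if "(i, j) \<in> (P \<union> P\<inverse>)\<^sup>*" for i j
    using that by induction (simp, metis edge)
  have "(i, j) \<in> (P \<union> P\<inverse>)\<^sup>*" for i j
    using assms(2) by (simp add: connected_graph_def P_def Let_def)
  \<comment> \<open>\<open>undefined\<close> is merely some vertex, taken as base point: the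
    constant is the value of \<open>z\<close> there.\<close>
  then have "z $ i = z $ undefined" for i
    by (rule reach)
  then have "z = (z $ undefined) *\<^sub>R (\<chi> i. 1)"
    by (simp add: vec_eq_iff)
  then show ?thesis ..
qed

theorem theorem1:
  fixes A :: "real^'n::finite^'m::finite"
    and b :: "real^'m"
    and E :: "('n \<times> 'n) set"
    and w :: "'n \<Rightarrow> 'n \<Rightarrow> real"
    and L Ldag :: "real^'n^'n"
    and x \<mu> :: "real^'n"
    and y l :: "real^'m"
  assumes "undirected_weighted_graph E w"
    and "connected_graph E w"
    and "is_graph_laplacian E w L"
    and "is_moore_penrose_inverse L Ldag"
    and "primal_solution A b L x"
    and "dual_solution A b L l \<mu>"
    and "y = l"
    and "KKT A b L x y l \<mu>"
  shows "\<exists>c::real.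
           x = Ldag *v (\<mu> - transpose A *v l) + c *\<^sub>R (\<chi> i. 1) \<and>
           KKT A b L (Ldag *v (\<mu> - transpose A *v l) + c *\<^sub>R (\<chi> i. 1)) y l \<mu>"
proof -
  have "L *v x = \<mu> - transpose A *v l"
    using assms(8) by (simp add: KKT_def algebra_simps)
  then have Ldag_eq: "Ldag *v (\<mu> - transpose A *v l) = (Ldag ** L) *v x"
    by (simp flip: matrix_vector_mul_assoc)
  have "L ** (Ldag ** L) = L"
    using assms(4) by (simp add: is_moore_penrose_inverse_def matrix_mul_assoc)
  then have "L *v (x - (Ldag ** L) *v x) = 0"
    by (simp add: matrix_vector_mult_diff_distrib matrix_vector_mul_assoc)
  then obtain c where "x - (Ldag ** L) *v x = c *\<^sub>R (\<chi> i. 1)"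
    using laplacian_kernel_constant assms(1-3) by blast
  then have "x = Ldag *v (\<mu> - transpose A *v l) + c *\<^sub>R (\<chi> i. 1)"
    unfolding Ldag_eq by (simp add: algebra_simps)
  \<comment> \<open>This \<open>c\<close> meets the KKT conditions because the shifted vector is
    \<open>x\<close> itself, for which they are given.\<close>
  with assms(8) show ?thesis by metis
qed

end
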